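(* Let $K\subset\mathbb{R}^2$ be a planar convex body and let $a_1,\dots,a_n\in\mathrm{bd}\,K$. (i) If $a_1,\dots,a_n$ weakly fix $K$, then both intersections $L(a_1)\cap\dots\cap L(a_n)$ and $R(a_1)\cap\dots\cap R(a_n)$ are empty. (ii) If the three intersections $\bar L(a_1)\cap\dots\cap\bar L(a_n)$, $\bar R(a_1)\cap\dots\cap\bar R(a_n)$ and $\vec L(a_1)\cap\dots\cap\vec L(a_n)$ are empty, then $a_1,\dots,a_n$ fix $K$.
   Context: The plane $\mathbb{R}^2$ carries its Euclidean norm; $\mathrm{bd}\,M$ and $\mathrm{int}\,M$ denote the boundary and interior of $M\subset\mathbb{R}^2$. A planar convex body is a compact convex subset of $\mathbb{R}^2$ with nonempty interior. $\mathbb{S}_1$ is the unit circle centred at the origin. $\mathrm{Isom}^+\mathbb{R}^2$ is the group of planar affine rotations and translations (orientation-preserving isometries) with its usual topology, and $\mathbf{id}$ is the identity of $\mathbb{R}^2$. Fixing: points $a_1,\dots,a_n\in\mathrm{bd}\,K$ fix $K$ if there is a neighbourhood $\mathcal{V}$ of $\mathbf{id}$ in $\mathrm{Isom}^+\mathbb{R}^2$ such that, for every $f\in\mathcal{V}$ with $f(K)\neq K$, at least one of the $a_i$ belongs to $\mathrm{int}\,f(K)$. Weakly fixing: points $a_1,\dots,a_n\in\mathrm{bd}\,K$ weakly fix $K$ if, for any (continuous) path $\gamma:[0,1]\to\mathrm{Isom}^+\mathbb{R}^2$, $t\mapsto\gamma_t$, such that $\gamma_0(K)=K$ and $\gamma_1(K)\neq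 K$, there exist $i\in\{1,\dots,n\}$ and $t\in[0,1]$ such that $a_i\in\mathrm{int}\,\gamma_t(K)$. Sectors: for an oriented line $D$, $D^+$ denotes the open half-plane on the left of $D$. Orient $\mathrm{bd}\,K$ counterclockwise. For $a\in\mathrm{bd}\,K$, let $T_\ell(a)$ and $T_r(a)$ be the left and right tangents to $\mathrm{bd}\,K$ at $a$ (the one-sided tangent lines on the side of $\mathrm{bd}\,K$ preceding $a$, respectively following $a$, in the counterclockwise orientation), oriented like $\mathrm{bd}\,K$, so that $\mathrm{int}\,K\subset T_\ell(a)^+\cap T_r(a)^+$. Let $N_\ell(a)$ (resp. $N_r(a)$) be the line through $a$ orthogonal to $T_\ell(a)$ (resp. $T_r(a)$), oriented in the direction pointing into $T_\ell(a)^+$ (resp. $T_r(a)^+$). Define the open set $$L(a)=N_\ell(a)^+\cup N_r(a)^+,$$ and let $R(a)$ be the analogous union of the two open half-planes on the right of $N_\ell(a)$ and $N_r(a)$. $\bar L(a)$ and $\bar R(a)$ are the corresponding closed sectors (closures of $L(a)$ and $R(a)$, i.e. the unions of the corresponding closed half-planes). The set of directions of $\bar L(a)$ is $\vec L(a)=\{x\in\mathbb{S}_1 : a+x\in\bar L(a)\}$. *)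

theory Defs
  imports "HOL-Analysis.Analysis"
begin

type_synonym plane = "real^2"

definition convex_body :: "plane set \<Rightarrow> bool" where
  "convex_body K \<longleftrightarrow> compact K \<and> convex K \<and> interior K \<noteq> {}"


subsection \<open>Orientation-preserving isometries\<close>

definition isom_plus :: "(plane \<Rightarrow> plane) set" where
  "isom_plus = {f. \<exists>A b. rotation_matrix A \<and> f = (\<lambda>x. A *v x + b)}"

text \<open>
  The topology on \<^const>\<open>isom_plus\<close> is the subspace topology inherited from the function type
  (pointwise convergence). The following fact shows that it is the usual one, in which isometries
  are topologised by their rotation matrix and translation vector.
\<close>

lemma isom_plus_homeomorphism:
  "homeomorphism ({A. rotation_matrix A} \<times> UNIV) isom_plus
     (\<lambda>(A, b) x. A *v x + b)
     (\<lambda>f. ((\<chi> i j. (f (axis j 1) - f 0) $ i), f 0))"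
proof (rule homeomorphismI)
  have "continuous_on UNIV (\<lambda>p::(real^2^2) \<times> plane. fst p *v x + snd p)" for x
    unfolding matrix_vector_mult_def by (intro continuous_intros)
  then have "continuous_on UNIV (\<lambda>(p::(real^2^2) \<times> plane) x. fst p *v x + snd p)"
    by (rule continuous_on_coordinatewise_then_product)
  then show "continuous_on ({A. rotation_matrix A} \<times> UNIV) (\<lambda>(A::real^2^2, b::plane) x. A *v x + b)"
    unfolding case_prod_beta by (rule continuous_on_subset) simp
  have ev: "continuous_on isom_plus (\<lambda>f. f x)" for x
    by (rule continuous_on_subset[OF continuous_on_product_coordinates]) simp
  show "continuous_on isom_plus
      (\<lambda>f. ((\<chi> i j. (f (axis j 1) - f 0) $ i)::real^2^2, f 0))"
    by (intro continuous_intros ev)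
  have col: "(\<chi> i j. (A *v axis j 1) $ i) = A" for A :: "real^2^2"
    by (simp add: vec_eq_iff matrix_vector_mul_component matrix_vector_mult_basis column_def)
  show "(\<lambda>(A, b) x. A *v x + b) ` ({A. rotation_matrix A} \<times> UNIV) \<subseteq> isom_plus"
    by (auto simp: isom_plus_def)
  show "(\<lambda>f. ((\<chi> i j. (f (axis j 1) - f 0) $ i), f 0)) ` isom_plus
      \<subseteq> {A. rotation_matrix A} \<times> UNIV"
    by (auto simp: isom_plus_def col)
  show "(\<lambda>f. ((\<chi> i j. (f (axis j 1) - f 0) $ i), f 0)) ((\<lambda>(A, b) x. A *v x + b) p) = p"
    if "p \<in> {A. rotation_matrix A} \<times> UNIV" for p :: "(real^2^2) \<times> plane"
    using that by (auto simp: col)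
  show "(\<lambda>(A, b) x. A *v x + b) ((\<lambda>f. ((\<chi> i j. (f (axis j 1) - f 0) $ i), f 0)) f) = f"
    if "f \<in> isom_plus" for f
    using that by (auto simp: isom_plus_def col)
qed


subsection \<open>Fixing and weakly fixing\<close>

definition fixing :: "plane set \<Rightarrow> nat \<Rightarrow> (nat \<Rightarrow> plane) \<Rightarrow> bool" where
  "fixing K n a \<longleftrightarrow>
     (\<exists>V. openin (top_of_set isom_plus) V \<and> id \<in> V \<and>
          (\<forall>f\<in>V. f ` K \<noteq> K \<longrightarrow> (\<exists>i\<in>{1..n}. a i \<in> interior (f ` K))))"

definition weakly_fixing :: "plane set \<Rightarrow> nat \<Rightarrow> (nat \<Rightarrow> plane) \<Rightarrow> bool" where
  "weakly_fixing K n a \<longleftrightarrow>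
     (\<forall>\<gamma> :: real \<Rightarrow> plane \<Rightarrow> plane.
        path \<gamma> \<and> path_image \<gamma> \<subseteq> isom_plus \<and> \<gamma> 0 ` K = K \<and> \<gamma> 1 ` K \<noteq> K \<longrightarrow>
        (\<exists>i\<in>{1..n}. \<exists>t\<in>{0..1}. a i \<in> interior (\<gamma> t ` K)))"


subsection \<open>Oriented lines and half-planes\<close>

definition rot90 :: "plane \<Rightarrow> plane" where
  "rot90 d = vector [- d $ 2, d $ 1]"

text \<open>
  An oriented line is given by a point \<open>p\<close> on it and a direction \<open>d\<close>. Note that
  \<open>rot90 d \<bullet> y\<close> is the determinant of the pair \<open>(d, y)\<close>.
\<close>

definition left_side :: "plane \<Rightarrow> plane \<Rightarrow> plane set" where
  "left_side p d = {x. rot90 d \<bullet> (x - p) > 0}"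

definition right_side :: "plane \<Rightarrow> plane \<Rightarrow> plane set" where
  "right_side p d = {x. rot90 d \<bullet> (x - p) < 0}"


subsection \<open>One-sided tangents\<close>

text \<open>
  Seen from an interior point \<open>c\<close> of \<open>K\<close>, moving counterclockwise along the boundary from \<open>a\<close>
  means moving to the left of the line from \<open>c\<close> through \<open>a\<close>. So the boundary points on the left
  (right) of this line form an arc that follows (precedes) \<open>a\<close>. The one-sided tangents at \<open>a\<close> are
  the limits of the secants through \<open>a\<close> along these arcs; near \<open>a\<close> the arcs, and hence the limits,
  do not depend on \<open>c\<close>.
\<close>

definition arc_after :: "plane set \<Rightarrow> plane \<Rightarrow> plane \<Rightarrow> plane set" where
  "arc_after K c a = frontier K \<inter> left_side c (a - c)"

definition arc_before :: "plane set \<Rightarrow> plane \<Rightarrow> plane \<Rightarrow> plane set" where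
  "arc_before K c a = frontier K \<inter> right_side c (a - c)"

definition left_tangent :: "plane set \<Rightarrow> plane \<Rightarrow> plane" where
  "left_tangent K a =
     (THE v. \<forall>c\<in>interior K. ((\<lambda>x. sgn (a - x)) \<longlongrightarrow> v) (at a within arc_before K c a))"

definition right_tangent :: "plane set \<Rightarrow> plane \<Rightarrow> plane" where
  "right_tangent K a =
     (THE v. \<forall>c\<in>interior K. ((\<lambda>x. sgn (x - a)) \<longlongrightarrow> v) (at a within arc_after K c a))"

text \<open>
  Directions of the inward normals: since \<open>rot90 d\<close> points to the left of \<open>d\<close>, they point into the
  open left half-planes of the corresponding tangents.
\<close>

definition left_normal :: "plane set \<Rightarrow> plane \<Rightarrow> plane" where
  "left_normal K a = rot90 (left_tangent K a)"

definition right_normal :: "plane set \<Rightarrow> plane \<Rightarrow> plane" where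
  "right_normal K a = rot90 (right_tangent K a)"


subsection \<open>Sectors\<close>

definition L_sector :: "plane set \<Rightarrow> plane \<Rightarrow> plane set" where
  "L_sector K a = left_side a (left_normal K a) \<union> left_side a (right_normal K a)"

definition R_sector :: "plane set \<Rightarrow> plane \<Rightarrow> plane set" where
  "R_sector K a = right_side a (left_normal K a) \<union> right_side a (right_normal K a)"

definition L_directions :: "plane set \<Rightarrow> plane \<Rightarrow> plane set" where
  "L_directions K a = {x \<in> sphere 0 1. a + x \<in> closure (L_sector K a)}"

end

theory Submission
  imports Defs
begin

text \<open>
  Convexity yields the one-sided tangents at a boundary point \<open>a\<close>: the body lies on the left of both
  of them, and every direction pointing strictly to the left of both enters the interior.

  (i) If \<open>p\<close> lies in all \<open>L(a\<^sub>i)\<close>, then under the backward motion of a counterclockwise rotation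
  of \<open>K\<close> about \<open>p\<close> each \<open>a\<^sub>i\<close> starts towards the outer side of one of its tangents, so the
  rotation moves \<open>K\<close> without any \<open>a\<^sub>i\<close> entering the interior. For \<open>R(a\<^sub>i)\<close> the rotation is
  clockwise.

  (ii) If the points do not fix \<open>K\<close>, isometries tending to the identity, suitably rescaled, converge to
  a nonzero infinitesimal isometry that moves no \<open>a\<^sub>i\<close> strictly to the left of both its tangents. It is
  an infinitesimal rotation, whose centre lies in all closed left or in all closed right sectors, or
  an infinitesimal translation, whose perpendicular direction lies in all direction sets.
\<close>

subsection \<open>Plane geometry\<close>

lemma inner_plane: "x \<bullet> y = x $ 1 * y $ 1 + x $ 2 * y $ 2" for x y :: plane
  by (simp add: inner_vec_def sum_2)

lemma rot90_nth [simp]: "rot90 x $ 1 = - x $ 2" "rot90 x $ 2 = x $ 1"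
  by (simp_all add: rot90_def)

lemma linear_rot90: "linear rot90"
  by (rule linearI) (simp_all add: vec_eq_iff forall_2)

lemmas rot90_simps [simp] =
  linear_0[OF linear_rot90] linear_add[OF linear_rot90] linear_diff[OF linear_rot90]
  linear_neg[OF linear_rot90] linear_scale[OF linear_rot90]

lemma rot90_rot90 [simp]: "rot90 (rot90 x) = - x"
  by (simp add: vec_eq_iff forall_2)

lemma inner_rot90_rot90 [simp]: "rot90 x \<bullet> rot90 y = x \<bullet> y"
  by (simp add: inner_plane)

lemma inner_rot90_self [simp]: "rot90 x \<bullet> x = 0" "x \<bullet> rot90 x = 0"
  by (simp_all add: inner_plane)

lemma inner_rot90_left: "rot90 x \<bullet> y = - (x \<bullet> rot90 y)"
  by (simp add: inner_plane)

lemma norm_rot90 [simp]: "norm (rot90 x) = norm x"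
  by (simp add: norm_eq_sqrt_inner)

lemma rot90_eq_0_iff [simp]: "rot90 x = 0 \<longleftrightarrow> x = 0"
  by (metis norm_eq_zero norm_rot90)

lemma bounded_linear_rot90: "bounded_linear rot90"
  using linear_rot90 by (simp add: linear_conv_bounded_linear)

lemmas continuous_on_rot90 [continuous_intros] =
  bounded_linear.continuous_on[OF bounded_linear_rot90]

lemma rot90_parallel:
  assumes "rot90 w \<bullet> v = 0" "norm w = 1" "norm v = 1"
  shows "v = w \<or> v = - w"
proof -
  obtain k where v: "v = k *\<^sub>R w"
  proof -
    have w: "w $ 1 * w $ 1 + w $ 2 * w $ 2 = 1"
      using assms(2) by (simp add: norm_eq_sqrt_inner inner_plane)
    have "w $ 1 * v $ 2 = w $ 2 * v $ 1"
      using assms(1) by (simp add: inner_plane)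
    then have "(w $ 1 * v $ 1 + w $ 2 * v $ 2) * w $ 1 = v $ 1 * (w $ 1 * w $ 1 + w $ 2 * w $ 2)"
      "(w $ 1 * v $ 1 + w $ 2 * v $ 2) * w $ 2 = v $ 2 * (w $ 1 * w $ 1 + w $ 2 * w $ 2)"
      by algebra+
    with w have "v = (w \<bullet> v) *\<^sub>R w"
      by (simp add: vec_eq_iff forall_2 inner_plane)
    then show thesis
      by (rule that)
  qed
  with assms(2,3) have "k = 1 \<or> k = - 1"
    by auto
  with v show ?thesis
    by auto
qed

text \<open>\<open>n\<close> and \<open>d\<close> are orthogonal and equally long, so this is the
  orthogonal expansion of \<open>y\<close>, multiplied by \<open>d \<bullet> d\<close> to avoid
  division. The sign \<open>s\<close> cancels because \<open>n\<close> occurs twice.\<close>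

lemma plane_decomposition:
  fixes d y :: plane
  assumes s: "s = 1 \<or> s = - 1" and n: "n = - s *\<^sub>R rot90 d"
  shows "(d \<bullet> d) *\<^sub>R y = (n \<bullet> y) *\<^sub>R n + (d \<bullet> y) *\<^sub>R d"
proof -
  have "(rot90 d \<bullet> y) *\<^sub>R rot90 d + (d \<bullet> y) *\<^sub>R d = (d \<bullet> d) *\<^sub>R y"
    unfolding vec_eq_iff forall_2 inner_plane by (simp add: algebra_simps)
  moreover have "(n \<bullet> y) *\<^sub>R n = (rot90 d \<bullet> y) *\<^sub>R rot90 d"
    using s unfolding n by auto
  ultimately show ?thesis
    by simp
qed

section \<open>Interior points and supporting functionals of convex sets\<close>

text \<open>A first step from \<open>a\<close> towards \<open>y\<close> reaches a point
  \<open>z\<close> of \<open>K\<close>; a further step of positive weight \<open>\<mu>\<close>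
  towards the interior point \<open>c\<close> lands in the interior.\<close>

lemma interior_convex_combination:
  fixes a y c :: plane
  assumes K: "convex K" and a: "a \<in> K" and y: "y \<in> K" and c: "c \<in> interior K"
    and l: "0 \<le> k" "0 < \<mu>" "k + \<mu> \<le> 1"
  shows "a + k *\<^sub>R (y - a) + \<mu> *\<^sub>R (c - a) \<in> interior K"
proof -
  \<comment> \<open>For \<open>\<mu> = 1\<close> the bounds force \<open>k = 0\<close>, and the
    quotient is 0 by the convention for division by zero, so \<open>z = a\<close>.\<close>
  define z where "z = a + (k / (1 - \<mu>)) *\<^sub>R (y - a)"
  have "z = (1 - k / (1 - \<mu>)) *\<^sub>R a + (k / (1 - \<mu>)) *\<^sub>R y"
    by (simp add: z_def algebra_simps)
  moreover have "0 \<le> k / (1 - \<mu>)" "k / (1 - \<mu>) \<le> 1"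
    using l by (auto simp: divide_le_eq)
  ultimately have "z \<in> K"
    using K a y by (simp add: convexD)
  then have "z - \<mu> *\<^sub>R (z - c) \<in> interior K"
    using mem_interior_convex_shrink[OF K c] l by simp
  moreover have "(1 - \<mu>) * (k / (1 - \<mu>)) = k"
    using l by (cases "\<mu> = 1") auto
  then have "k *\<^sub>R (y - a) = ((1 - \<mu>) * (k / (1 - \<mu>))) *\<^sub>R (y - a)"
    by (simp only:)
  then have "z - \<mu> *\<^sub>R (z - c) = a + k *\<^sub>R (y - a) + \<mu> *\<^sub>R (c - a)"
    unfolding z_def left_diff_distrib scaleR_left_diff_distrib
    by (simp add: scaleR_right_diff_distrib scaleR_add_right algebra_simps)
  ultimately show ?thesis by simp
qed

text \<open>Around \<open>c\<close> there is room for a step against \<open>h\<close> inside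
  \<open>K\<close>, and the functional, which decreases along it, is still nonnegative at its
  end.\<close>

lemma support_pos:
  fixes h :: plane
  assumes "\<forall>x\<in>K. 0 \<le> h \<bullet> (x - a)" "h \<noteq> 0" "c \<in> interior K"
  shows "0 < h \<bullet> (c - a)"
proof -
  obtain e where e: "e > 0" "cball c e \<subseteq> K"
    using assms(3) by (meson mem_interior_cball)
  have "c - (e / norm h) *\<^sub>R h \<in> K"
    using e assms(2) by (intro subsetD[OF e(2)]) (simp add: dist_norm)
  then have "(e / norm h) * (h \<bullet> h) \<le> h \<bullet> (c - a)"
    using assms(1) by (fastforce simp: inner_diff_right)
  moreover have "0 < (e / norm h) * (h \<bullet> h)"
    using e assms(2) by simp
  ultimately show ?thesis by linarith
qed

subsection \<open>One-sided tangents of a convex body\<close>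

lemma supporting_normal:
  fixes K :: "plane set"
  assumes "convex_body K" "a \<in> frontier K"
  obtains h where "h \<noteq> 0" "\<forall>x\<in>K. 0 \<le> h \<bullet> (x - a)"
proof -
  have K: "convex K" "closed K" "rel_interior K = interior K"
    using assms(1) by (auto simp: convex_body_def compact_imp_closed rel_interior_nonempty_interior)
  have "a \<in> K" "a \<notin> rel_interior K"
    using assms(2) K by (auto simp: frontier_def)
  then show ?thesis
    using supporting_hyperplane_rel_boundary[OF K(1)] that
    by (metis diff_ge_0_iff_ge inner_diff_right)
qed

text \<open>Otherwise \<open>a\<close> would lie strictly between the interior point
  \<open>c\<close> and a point of \<open>K\<close> beyond \<open>a\<close>, and so be
  interior.\<close>

lemma not_mem_behind_frontier:
  fixes a c :: plane
  assumes K: "convex K" and a: "a \<notin> interior K" and c: "c \<in> interior K" and \<eta>: "0 < \<eta>"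
  shows "a - \<eta> *\<^sub>R (c - a) \<notin> K"
proof
  define y where "y = a - \<eta> *\<^sub>R (c - a)"
  assume "a - \<eta> *\<^sub>R (c - a) \<in> K"
  then have y: "y \<in> K" by (simp add: y_def)
  have "(\<eta> / (1 + \<eta>)) *\<^sub>R (c - y) = (\<eta> / (1 + \<eta>)) *\<^sub>R ((1 + \<eta>) *\<^sub>R (c - a))"
    by (simp add: y_def algebra_simps)
  then have "(\<eta> / (1 + \<eta>)) *\<^sub>R (c - y) = \<eta> *\<^sub>R (c - a)"
    using \<eta> by simp
  then show False
    using interior_convex_combination[OF K y y c, of 0 "\<eta> / (1 + \<eta>)"] \<eta> a
    by (simp add: y_def)
qed

text \<open>This makes the one-sided limits at \<open>a\<close> nontrivial. Two points of the line
  through \<open>a\<close> and \<open>c\<close>, one inside and one outside \<open>K\<close>, are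
  shifted by the same small multiple of \<open>n\<close>; the segment joining them crosses the
  frontier.\<close>

lemma frontier_half_plane_limpt:
  fixes K :: "plane set"
  assumes K: "convex_body K" and a: "a \<in> frontier K" and c: "c \<in> interior K"
    and n: "n \<noteq> 0" "n \<bullet> (c - a) = 0"
  shows "a islimpt {x \<in> frontier K. 0 < n \<bullet> (x - a)}"
  unfolding islimpt_approachable
proof (intro allI impI)
  fix e :: real
  assume e: "0 < e"
  have cvx: "convex K" "closed K"
    using K by (auto simp: convex_body_def compact_imp_closed)
  have aK: "a \<in> K" "a \<notin> interior K"
    using a cvx by (auto simp: frontier_def)
  define d where "d = c - a"
  have d: "d \<noteq> 0"
    using aK c by (auto simp: d_def)
  \<comment> \<open>\<open>\<eta>\<close> and \<open>\<tau>\<close> are so small that the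
    displacements along \<open>d\<close> and \<open>n\<close> are each shorter than
    \<open>e / 2\<close>; \<open>\<tau>\<close> also keeps \<open>p\<close> inside and
    \<open>q\<close> outside \<open>K\<close>.\<close>
  define \<eta> where "\<eta> = min (1 / 2) (e / (4 * norm d))"
  have \<eta>: "0 < \<eta>" "\<eta> < 1" "\<eta> * norm d < e / 2"
  proof -
    have "\<eta> * norm d \<le> e / (4 * norm d) * norm d"
      by (intro mult_right_mono) (auto simp: \<eta>_def)
    then show "\<eta> * norm d < e / 2"
      using d e by simp
  qed (use d e in \<open>auto simp: \<eta>_def\<close>)
  have in1: "a + \<eta> *\<^sub>R d \<in> interior K"
    using interior_convex_combination[OF cvx(1) aK(1) aK(1) c, of 0 \<eta>] \<eta>
    by (simp add: d_def)
  have out: "a - \<eta> *\<^sub>R d \<notin> K"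
    using not_mem_behind_frontier[OF cvx(1) aK(2) c \<eta>(1)] by (simp add: d_def)
  obtain r1 where r1: "r1 > 0" "ball (a + \<eta> *\<^sub>R d) r1 \<subseteq> K"
    using in1 by (meson mem_interior)
  obtain r2 where r2: "r2 > 0" "ball (a - \<eta> *\<^sub>R d) r2 \<subseteq> - K"
    using out cvx(2) by (meson ComplI open_Compl openE)
  define \<tau> where "\<tau> = min (min r1 r2) e / (4 * norm n)"
  have \<tau>: "0 < \<tau>" "\<tau> * norm n < r1" "\<tau> * norm n < r2" "\<tau> * norm n < e / 2"
    using r1(1) r2(1) e n by (auto simp: \<tau>_def)
  define p q where "p = a + \<eta> *\<^sub>R d + \<tau> *\<^sub>R n" and "q = a - \<eta> *\<^sub>R d + \<tau> *\<^sub>R n"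
  have "p \<in> K"
    using r1(2) \<tau> by (intro subsetD[OF r1(2)]) (simp add: p_def dist_norm)
  moreover have "q \<in> - K"
    using \<tau> by (intro subsetD[OF r2(2)]) (simp add: q_def dist_norm)
  ultimately have "closed_segment q p \<inter> frontier K \<noteq> {}"
    by (intro connected_Int_frontier) auto
  then obtain x where x: "x \<in> closed_segment q p" "x \<in> frontier K"
    by blast
  obtain u where u: "0 \<le> u" "u \<le> 1" "x = (1 - u) *\<^sub>R q + u *\<^sub>R p"
    using x(1) by (auto simp: in_segment)
  have xa: "x - a = ((2 * u - 1) * \<eta>) *\<^sub>R d + \<tau> *\<^sub>R n"
    unfolding u(3) p_def q_def vec_eq_iff by (simp add: algebra_simps)
  have pos: "0 < n \<bullet> (x - a)"
    using n \<tau>(1) by (simp add: xa inner_add_right d_def)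
  have "norm (x - a) \<le> \<bar>2 * u - 1\<bar> * (\<eta> * norm d) + \<tau> * norm n"
    unfolding xa using norm_triangle_ineq[of "((2 * u - 1) * \<eta>) *\<^sub>R d" "\<tau> *\<^sub>R n"] \<eta>(1) \<tau>(1)
    by (simp add: abs_mult)
  also have "\<dots> \<le> 1 * (\<eta> * norm d) + \<tau> * norm n"
    using u \<eta> by (intro add_mono mult_right_mono) auto
  finally have "dist x a < e"
    using \<eta>(3) \<tau>(4) by (simp add: dist_norm)
  then show "\<exists>x'\<in>{x \<in> frontier K. 0 < n \<bullet> (x - a)}. x' \<noteq> a \<and> dist x' a < e"
    using x(2) pos by (intro bexI[of _ x]) auto
qed

text \<open>
  In the coordinates given by \<open>d = c - a\<close> and its perpendicular \<open>n\<close>, the body lies, on the side of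
  \<open>n\<close>, above the line through \<open>a\<close> of slope \<open>m\<close>, the infimum of the slopes of the points of \<open>K\<close>.
  A boundary point near \<open>a\<close> cannot have slope greater than that of some \<open>y \<in> K\<close>, as it would be
  interior to the hull of \<open>a\<close>, \<open>y\<close> and a ball around \<open>c\<close>.
\<close>

lemma one_sided_limit:
  fixes K :: "plane set"
  assumes K: "convex_body K" and a: "a \<in> frontier K" and c: "c \<in> interior K"
    and s: "s = 1 \<or> s = - 1"
  obtains w where "norm w = 1"
    "((\<lambda>x. sgn (x - a)) \<longlongrightarrow> w) (at a within {x \<in> frontier K. 0 < s * (rot90 (a - c) \<bullet> (x - a))})"
    "\<forall>x\<in>K. 0 \<le> s * (rot90 w \<bullet> (x - a))"
    "\<forall>u. 0 \<le> s * (rot90 (a - c) \<bullet> u) \<longrightarrow> 0 < s * (rot90 w \<bullet> u) \<longrightarrow>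
       (\<exists>t>0. a + t *\<^sub>R u \<in> interior K)"
proof -
  have cvx: "convex K" "closed K"
    using K by (auto simp: convex_body_def compact_imp_closed)
  have aK: "a \<in> K" "a \<notin> interior K"
    using a cvx by (auto simp: frontier_def)
  define d where "d = c - a"
  \<comment> \<open>The sign makes \<open>n\<close> point to the side of the arc: the arc after
    \<open>a\<close> for \<open>s = 1\<close>, before \<open>a\<close> for
    \<open>s = - 1\<close>.\<close>
  define n where "n = - s *\<^sub>R rot90 d"
  have d: "d \<noteq> 0"
    using aK c by (auto simp: d_def)
  then have dd: "0 < d \<bullet> d" by simp
  have s2: "s * s = 1" using s by auto
  have nu: "s * (rot90 (a - c) \<bullet> u) = n \<bullet> u" for u
    by (simp add: n_def d_def inner_diff_left algebra_simps)
  have nd: "n \<bullet> d = 0" "d \<bullet> n = 0" "n \<noteq> 0"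
    using d s by (auto simp: n_def)
  have decomp: "(d \<bullet> d) *\<^sub>R y = (n \<bullet> y) *\<^sub>R n + (d \<bullet> y) *\<^sub>R d" for y
    using plane_decomposition[OF s n_def] .
  obtain h where h: "h \<noteq> 0" "\<forall>x\<in>K. 0 \<le> h \<bullet> (x - a)"
    using supporting_normal[OF K a] .
  have hd: "0 < h \<bullet> d"
    using support_pos[OF h(2,1) c] by (simp add: d_def)
  define X where "X = {x \<in> K. 0 < n \<bullet> (x - a)}"
  define A where "A = {x \<in> frontier K. 0 < n \<bullet> (x - a)}"
  have lim: "a islimpt A"
    unfolding A_def using frontier_half_plane_limpt[OF K a c nd(3)] nd(1) d_def by simp
  have AX: "A \<subseteq> X"
    using cvx(2) by (auto simp: A_def X_def frontier_def)
  have Xne: "X \<noteq> {}"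
    using lim AX by (metis islimpt_EMPTY subset_empty)
  define slope where "slope x = (d \<bullet> (x - a)) / (n \<bullet> (x - a))" for x
  define m where "m = (INF x\<in>X. slope x)"
  \<comment> \<open>The supporting normal bounds the slopes: expand
    \<open>h \<bullet> (x - a)\<close> along \<open>n\<close> and \<open>d\<close>, and use
    \<open>h \<bullet> d > 0\<close>.\<close>
  have bdd: "bdd_below (slope ` X)"
  proof (rule bdd_belowI2)
    fix x assume x: "x \<in> X"
    have "0 \<le> (d \<bullet> d) * (h \<bullet> (x - a))"
      using h(2) x dd by (auto simp: X_def)
    also have "\<dots> = h \<bullet> ((d \<bullet> d) *\<^sub>R (x - a))" by simp
    also have "\<dots> = (n \<bullet> (x - a)) * (h \<bullet> n) + (d \<bullet> (x - a)) * (h \<bullet> d)"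
      unfolding decomp by (simp add: inner_add_right)
    finally show "- (h \<bullet> n) / (h \<bullet> d) \<le> slope x"
      using x hd by (simp add: slope_def X_def field_simps)
  qed
  have m_le: "m \<le> slope x" if "x \<in> X" for x
    unfolding m_def using bdd that by (rule cINF_lower)
  have m_approx: "\<exists>y\<in>X. slope y < k" if "m < k" for k
    using that Xne bdd unfolding m_def by (simp add: cINF_less_iff)
  have shear: "N *\<^sub>R n + D *\<^sub>R d = (N / p) *\<^sub>R (p *\<^sub>R n + q *\<^sub>R d) + (D - N * (q / p)) *\<^sub>R d"
    if "p \<noteq> 0" for N D p q
    using that by (simp add: algebra_simps)
  \<comment> \<open>Coordinates of \<open>u\<close> in the basis \<open>y - a\<close>,
    \<open>d\<close>. The sign of the second one tells on which side of the line through
    \<open>a\<close> and \<open>y\<close> the point \<open>a + u\<close> lies.\<close>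
  have comb: "u = ((n \<bullet> u) / (n \<bullet> (y - a))) *\<^sub>R (y - a)
      + ((d \<bullet> u - (n \<bullet> u) * slope y) / (d \<bullet> d)) *\<^sub>R d" if "y \<in> X" for u y
  proof -
    have ny: "0 < n \<bullet> (y - a)" using that by (simp add: X_def)
    have "(d \<bullet> d) *\<^sub>R u = (n \<bullet> u) *\<^sub>R n + (d \<bullet> u) *\<^sub>R d"
      by (rule decomp)
    also have "\<dots> = ((n \<bullet> u) / (n \<bullet> (y - a))) *\<^sub>R ((n \<bullet> (y - a)) *\<^sub>R n + (d \<bullet> (y - a)) *\<^sub>R d)
       + (d \<bullet> u - (n \<bullet> u) * slope y) *\<^sub>R d"
      unfolding slope_def using ny by (intro shear) simp
    also have "\<dots> = (d \<bullet> d) *\<^sub>R (((n \<bullet> u) / (n \<bullet> (y - a))) *\<^sub>R (y - a)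
      + ((d \<bullet> u - (n \<bullet> u) * slope y) / (d \<bullet> d)) *\<^sub>R d)"
      unfolding decomp[symmetric] using dd by (simp add: scaleR_add_right)
    finally show ?thesis
      using dd by (simp only: scaleR_cancel_left) simp
  qed
  have lim_slope: "(slope \<longlongrightarrow> m) (at a within A)"
  proof (rule order_tendstoI)
    fix k assume "k < m"
    then show "\<forall>\<^sub>F x in at a within A. k < slope x"
      unfolding eventually_at_filter using m_le AX
      by (intro always_eventually) (fastforce dest!: subsetD)
  next
    fix k assume "m < k"
    then obtain y where y: "y \<in> X" "slope y < k"
      using m_approx by blast
    \<comment> \<open>The sum of the two coordinates of \<open>x - a\<close> in the basis
      \<open>y - a\<close>, \<open>d\<close>. It tends to 0, so near \<open>a\<close> it satisfies
      the bound required by \<open>interior_convex_combination\<close>.\<close>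
    define \<phi> where "\<phi> x = (n \<bullet> (x - a)) / (n \<bullet> (y - a))
        + (d \<bullet> (x - a) - (n \<bullet> (x - a)) * slope y) / (d \<bullet> d)" for x
    have "(\<phi> \<longlongrightarrow> \<phi> a) (at a within A)"
      unfolding \<phi>_def using y dd by (intro tendsto_intros) (auto simp: X_def)
    moreover have "\<phi> a = 0" by (simp add: \<phi>_def)
    ultimately have "\<forall>\<^sub>F x in at a within A. \<phi> x < 1"
      by (intro order_tendstoD(2)) auto
    moreover have "\<forall>\<^sub>F x in at a within A. x \<in> A"
      by (simp add: eventually_at_filter)
    ultimately show "\<forall>\<^sub>F x in at a within A. slope x < k"
    proof eventually_elim
      case (elim x)
      show ?case
      proof (rule ccontr)
        assume "\<not> slope x < k"
        with y have "slope y < slope x" by simp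
        then have "0 < d \<bullet> (x - a) - (n \<bullet> (x - a)) * slope y"
          using elim(2) by (simp add: A_def slope_def field_simps)
        then have "a + ((n \<bullet> (x - a)) / (n \<bullet> (y - a))) *\<^sub>R (y - a)
            + ((d \<bullet> (x - a) - (n \<bullet> (x - a)) * slope y) / (d \<bullet> d)) *\<^sub>R (c - a) \<in> interior K"
          using elim y dd
          by (intro interior_convex_combination[OF cvx(1) aK(1) _ c]) (auto simp: A_def X_def \<phi>_def)
        then have "x \<in> interior K"
          using comb[OF y(1), of "x - a"] by (simp add: d_def add.assoc)
        with elim(2) show False
          by (simp add: A_def frontier_def)
      qed
    qed
  qed
  \<comment> \<open>The direction of slope \<open>m\<close>. On the arc
    \<open>n \<bullet> (x - a)\<close> is positive, so \<open>sgn (x - a)\<close> depends on the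
    slope only.\<close>
  define v where "v = n + m *\<^sub>R d"
  have v0: "v \<noteq> 0"
  proof
    assume "v = 0"
    then have "n \<bullet> v = 0" by simp
    then show False using nd by (simp add: v_def inner_add_right)
  qed
  have "((\<lambda>x. sgn (n + slope x *\<^sub>R d)) \<longlongrightarrow> sgn v) (at a within A)"
    unfolding v_def using v0 by (intro tendsto_intros lim_slope) (simp add: v_def)
  moreover have "\<forall>\<^sub>F x in at a within A. sgn (n + slope x *\<^sub>R d) = sgn (x - a)"
    unfolding eventually_at_filter
  proof (intro always_eventually allI impI)
    fix x assume "x \<in> A"
    then have nx: "0 < n \<bullet> (x - a)" by (simp add: A_def)
    have "sgn (x - a) = sgn ((d \<bullet> d) *\<^sub>R (x - a))"
      using dd by (simp add: sgn_scaleR)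
    also have "(d \<bullet> d) *\<^sub>R (x - a) = (n \<bullet> (x - a)) *\<^sub>R (n + slope x *\<^sub>R d)"
      unfolding decomp slope_def using nx by (simp add: scaleR_add_right)
    also have "sgn \<dots> = sgn (n + slope x *\<^sub>R d)"
      using nx by (simp add: sgn_scaleR)
    finally show "sgn (n + slope x *\<^sub>R d) = sgn (x - a)" ..
  qed
  ultimately have lim_sgn: "((\<lambda>x. sgn (x - a)) \<longlongrightarrow> sgn v) (at a within A)"
    by (rule Lim_transform_eventually)
  have vu: "s * (rot90 v \<bullet> u) = d \<bullet> u - m * (n \<bullet> u)" for u
    using s2 by (simp add: v_def n_def inner_add_left algebra_simps)
  have supp: "0 \<le> d \<bullet> (x - a) - m * (n \<bullet> (x - a))" if x: "x \<in> K" for x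
  proof (rule ccontr)
    assume neg: "\<not> ?thesis"
    show False
    proof (cases "0 < n \<bullet> (x - a)")
      case True
      then show False
        using m_le[of x] neg x by (simp add: X_def slope_def field_simps)
    next
      case False
      \<comment> \<open>Being strictly below the line of slope \<open>m\<close>, \<open>x\<close> is
        also strictly below the line through \<open>a\<close> and a suitable \<open>y\<close>; if
        \<open>n \<bullet> (x - a) = 0\<close>, any \<open>y\<close> in \<open>X\<close> will
        do.\<close>
      obtain y where y: "y \<in> X" "d \<bullet> (x - a) - (n \<bullet> (x - a)) * slope y < 0"
      proof (cases "n \<bullet> (x - a) = 0")
        case True
        with neg Xne show ?thesis using that by fastforce
      next
        case N: False
        with False neg have "m < (d \<bullet> (x - a)) / (n \<bullet> (x - a))"
          by (simp add: less_divide_eq)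
        then obtain y where "y \<in> X" "slope y < (d \<bullet> (x - a)) / (n \<bullet> (x - a))"
          using m_approx by blast
        with N False show ?thesis
          by (intro that[of y]) (auto simp: less_divide_eq mult.commute)
      qed
      define k l where "k = - ((n \<bullet> (x - a)) / (n \<bullet> (y - a)))"
        and "l = - ((d \<bullet> (x - a) - (n \<bullet> (x - a)) * slope y) / (d \<bullet> d))"
      have k: "0 \<le> k" and l: "0 < l"
        using False y dd by (auto simp: k_def l_def X_def divide_le_0_iff divide_less_0_iff)
      \<comment> \<open>With both coordinates negated, a convex combination of \<open>x\<close> and
        \<open>y\<close> appears on the ray from \<open>c\<close> through \<open>a\<close>, beyond
        \<open>a\<close>.\<close>
      have "x - a = - k *\<^sub>R (y - a) - l *\<^sub>R (c - a)"
        using comb[OF y(1), of "x - a"] by (simp add: k_def l_def d_def)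
      then have "x + k *\<^sub>R y = (1 + k) *\<^sub>R a - l *\<^sub>R (c - a)"
        by (simp add: algebra_simps)
      then have "(1 / (1 + k)) *\<^sub>R (x + k *\<^sub>R y)
          = (1 / (1 + k)) *\<^sub>R ((1 + k) *\<^sub>R a - l *\<^sub>R (c - a))"
        by (simp only:)
      also have "\<dots> = a - (l / (1 + k)) *\<^sub>R (c - a)"
        using k by (simp add: scaleR_diff_right)
      finally have "(1 / (1 + k)) *\<^sub>R x + (k / (1 + k)) *\<^sub>R y = a - (l / (1 + k)) *\<^sub>R (c - a)"
        by (simp add: scaleR_add_right)
      moreover have "(1 / (1 + k)) *\<^sub>R x + (k / (1 + k)) *\<^sub>R y \<in> K"
        using x y(1) k by (intro convexD[OF cvx(1)]) (auto simp: X_def add_divide_distrib[symmetric])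
      ultimately show False
        using not_mem_behind_frontier[OF cvx(1) aK(2) c, of "l / (1 + k)"] k l by simp
    qed
  qed
  have cone: "\<exists>t>0. a + t *\<^sub>R u \<in> interior K"
    if u: "0 \<le> n \<bullet> u" "0 < d \<bullet> u - m * (n \<bullet> u)" for u
  proof -
    obtain y where y: "y \<in> X" "0 < d \<bullet> u - (n \<bullet> u) * slope y"
    proof (cases "n \<bullet> u = 0")
      case True
      with u Xne show ?thesis using that by fastforce
    next
      case False
      with u have "m < (d \<bullet> u) / (n \<bullet> u)" by (simp add: field_simps)
      then obtain y where "y \<in> X" "slope y < (d \<bullet> u) / (n \<bullet> u)"
        using m_approx by blast
      with False u show ?thesis by (intro that[of y]) (auto simp: field_simps)
    qed
    define k \<mu> where "k = (n \<bullet> u) / (n \<bullet> (y - a))" and "\<mu> = (d \<bullet> u - (n \<bullet> u) * slope y) / (d \<bullet> d)"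
    have k: "0 \<le> k" "0 < \<mu>"
      using u y dd by (auto simp: k_def \<mu>_def X_def)
    \<comment> \<open>\<open>t\<close> scales \<open>u\<close> so that its two coordinates sum to
      1.\<close>
    define t where "t = 1 / (k + \<mu>)"
    have t: "0 < t" "t * k + t * \<mu> \<le> 1"
      using k by (auto simp: t_def add_divide_distrib[symmetric])
    have "a + (t * k) *\<^sub>R (y - a) + (t * \<mu>) *\<^sub>R (c - a) \<in> interior K"
      using k t y by (intro interior_convex_combination[OF cvx(1) aK(1) _ c]) (auto simp: X_def)
    moreover have "t *\<^sub>R u = (t * k) *\<^sub>R (y - a) + (t * \<mu>) *\<^sub>R (c - a)"
      by (subst comb[OF y(1), of u]) (simp add: k_def \<mu>_def d_def scaleR_add_right)
    ultimately show ?thesis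
      using t(1) by (auto simp: add.assoc)
  qed
  have sg: "s * (rot90 (sgn v) \<bullet> u) = (d \<bullet> u - m * (n \<bullet> u)) / norm v" for u
    unfolding vu[symmetric] by (simp add: sgn_div_norm divide_inverse)
  show thesis
  proof (rule that[of "sgn v"])
    show "norm (sgn v) = 1" using v0 by (simp add: norm_sgn)
    show "((\<lambda>x. sgn (x - a)) \<longlongrightarrow> sgn v) (at a within {x \<in> frontier K. 0 < s * (rot90 (a - c) \<bullet> (x - a))})"
      unfolding nu using lim_sgn by (simp add: A_def)
    show "\<forall>x\<in>K. 0 \<le> s * (rot90 (sgn v) \<bullet> (x - a))"
      unfolding sg using supp v0 by simp
    show "\<forall>u. 0 \<le> s * (rot90 (a - c) \<bullet> u) \<longrightarrow> 0 < s * (rot90 (sgn v) \<bullet> u) \<longrightarrow>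
       (\<exists>t>0. a + t *\<^sub>R u \<in> interior K)"
      unfolding sg nu using cone v0 by (simp add: zero_less_divide_iff)
  qed
qed

text \<open>The functional is nonnegative on every \<open>sgn (x - a)\<close> with \<open>x\<close>
  in \<open>S\<close>, and this passes to the limit since \<open>a\<close> is a limit point.\<close>

lemma limit_direction_in_dual:
  fixes K :: "plane set"
  assumes "((\<lambda>x. sgn (x - a)) \<longlongrightarrow> w) (at a within S)" "S \<subseteq> K" "a islimpt S"
    and "\<forall>x\<in>K. 0 \<le> h \<bullet> (x - a)"
  shows "0 \<le> h \<bullet> w"
proof (rule tendsto_lowerbound)
  show "((\<lambda>x. h \<bullet> sgn (x - a)) \<longlongrightarrow> h \<bullet> w) (at a within S)"
    by (intro tendsto_intros assms)
  show "\<forall>\<^sub>F x in at a within S. 0 \<le> h \<bullet> sgn (x - a)"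
    using assms(2,4) unfolding eventually_at_filter
    by (intro always_eventually) (auto simp: sgn_div_norm)
  show "at a within S \<noteq> bot"
    using assms(3) by (simp add: trivial_limit_within)
qed

text \<open>
  The limit does not depend on \<open>c\<close>: two limits support \<open>K\<close> on the same side and are directions of the
  closed tangent cone, so each lies on the left of the other; hence they are parallel, and they
  are not opposite since \<open>K\<close> has interior points.
\<close>

lemma one_sided_direction:
  fixes K :: "plane set"
  assumes K: "convex_body K" and a: "a \<in> frontier K" and s: "s = 1 \<or> s = - 1"
  obtains w where "norm w = 1"
    "\<forall>c\<in>interior K. ((\<lambda>x. sgn (x - a)) \<longlongrightarrow> w)
       (at a within {x \<in> frontier K. 0 < s * (rot90 (a - c) \<bullet> (x - a))})"
    "\<forall>c\<in>interior K. a islimpt {x \<in> frontier K. 0 < s * (rot90 (a - c) \<bullet> (x - a))}"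
    "\<forall>x\<in>K. 0 \<le> s * (rot90 w \<bullet> (x - a))"
    "\<forall>c\<in>interior K. \<forall>u. 0 \<le> s * (rot90 (a - c) \<bullet> u) \<longrightarrow> 0 < s * (rot90 w \<bullet> u) \<longrightarrow>
       (\<exists>t>0. a + t *\<^sub>R u \<in> interior K)"
proof -
  define A where "A c = {x \<in> frontier K. 0 < s * (rot90 (a - c) \<bullet> (x - a))}" for c
  define good where "good c w \<longleftrightarrow> norm w = 1 \<and> ((\<lambda>x. sgn (x - a)) \<longlongrightarrow> w) (at a within A c) \<and>
     (\<forall>x\<in>K. 0 \<le> s * (rot90 w \<bullet> (x - a))) \<and>
     (\<forall>u. 0 \<le> s * (rot90 (a - c) \<bullet> u) \<longrightarrow> 0 < s * (rot90 w \<bullet> u) \<longrightarrow>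
       (\<exists>t>0. a + t *\<^sub>R u \<in> interior K))" for c w
  have ex: "\<exists>w. good c w" if "c \<in> interior K" for c
  proof (rule one_sided_limit[OF K a that s])
    fix w
    assume "norm w = 1"
      "((\<lambda>x. sgn (x - a)) \<longlongrightarrow> w) (at a within {x \<in> frontier K. 0 < s * (rot90 (a - c) \<bullet> (x - a))})"
      "\<forall>x\<in>K. 0 \<le> s * (rot90 w \<bullet> (x - a))"
      "\<forall>u. 0 \<le> s * (rot90 (a - c) \<bullet> u) \<longrightarrow> 0 < s * (rot90 w \<bullet> u) \<longrightarrow>
         (\<exists>t>0. a + t *\<^sub>R u \<in> interior K)"
    then show "\<exists>w. good c w"
      unfolding good_def A_def by (intro exI[of _ w] conjI)
  qed
  have AK: "A c \<subseteq> K" for c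
    using K by (auto simp: A_def convex_body_def compact_imp_closed frontier_def)
  have lim: "a islimpt A c" if c: "c \<in> interior K" for c
  proof -
    have "c \<noteq> a" using a c by (auto simp: frontier_def)
    then have "rot90 (a - c) \<noteq> 0"
      unfolding rot90_eq_0_iff by simp
    then have "s *\<^sub>R rot90 (a - c) \<noteq> 0"
      using s by auto
    moreover have "rot90 (a - c) \<bullet> (c - a) = 0"
      by (metis inner_minus_right inner_rot90_self(1) minus_diff_eq neg_equal_0_iff_equal)
    ultimately show ?thesis
      using frontier_half_plane_limpt[OF K a c, of "s *\<^sub>R rot90 (a - c)"] by (simp add: A_def)
  qed
  have uniq: "w' = w" if c: "c \<in> interior K" "c' \<in> interior K" and g: "good c w" "good c' w'" for c c' w w'
  proof -
    have w: "\<forall>x\<in>K. 0 \<le> (s *\<^sub>R rot90 w) \<bullet> (x - a)" "\<forall>x\<in>K. 0 \<le> (s *\<^sub>R rot90 w') \<bullet> (x - a)"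
      using g by (auto simp: good_def)
    have "0 \<le> (s *\<^sub>R rot90 w) \<bullet> w'"
      using g(2) w(1) AK lim[OF c(2)] by (intro limit_direction_in_dual[of a w' "A c'" K]) (auto simp: good_def)
    moreover have "0 \<le> (s *\<^sub>R rot90 w') \<bullet> w"
      using g(1) w(2) AK lim[OF c(1)] by (intro limit_direction_in_dual[of a w "A c" K]) (auto simp: good_def)
    \<comment> \<open>\<open>rot90 w \<bullet> w'\<close> changes sign when \<open>w\<close> and
      \<open>w'\<close> are exchanged, so the two inequalities force it to vanish.\<close>
    ultimately have "rot90 w \<bullet> w' = 0"
      using s inner_rot90_left[of w w'] by (auto simp: inner_commute)
    then have "w' = w \<or> w' = - w"
      using g by (intro rot90_parallel) (auto simp: good_def)
    moreover have "w' \<noteq> - w"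
    proof
      assume "w' = - w"
      have "norm (s *\<^sub>R rot90 w) = 1"
        using g(1) s by (auto simp: good_def)
      then have "s *\<^sub>R rot90 w \<noteq> 0" by (metis norm_zero zero_neq_one)
      then have "0 < (s *\<^sub>R rot90 w) \<bullet> (c - a)"
        using support_pos w(1) c by blast
      moreover have "0 \<le> (s *\<^sub>R rot90 w') \<bullet> (c - a)"
        using w(2) c interior_subset by blast
      ultimately show False
        using \<open>w' = - w\<close> by simp
    qed
    ultimately show ?thesis by blast
  qed
  obtain c where c: "c \<in> interior K"
    using K by (auto simp: convex_body_def)
  obtain w where w: "good c w"
    using ex[OF c] by blast
  have all: "good c' w" if c': "c' \<in> interior K" for c'
  proof -
    obtain w' where "good c' w'"
      using ex[OF c'] by blast
    with uniq[OF c c' w this] show ?thesis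
      by simp
  qed
  show thesis
  proof (rule that[of w])
    show "\<forall>c\<in>interior K. ((\<lambda>x. sgn (x - a)) \<longlongrightarrow> w)
       (at a within {x \<in> frontier K. 0 < s * (rot90 (a - c) \<bullet> (x - a))})"
      using all unfolding good_def A_def by blast
    show "\<forall>c\<in>interior K. a islimpt {x \<in> frontier K. 0 < s * (rot90 (a - c) \<bullet> (x - a))}"
      using lim unfolding A_def by blast
    show "\<forall>c\<in>interior K. \<forall>u. 0 \<le> s * (rot90 (a - c) \<bullet> u) \<longrightarrow> 0 < s * (rot90 w \<bullet> u) \<longrightarrow>
       (\<exists>t>0. a + t *\<^sub>R u \<in> interior K)"
      using all unfolding good_def by blast
  qed (use w in \<open>auto simp: good_def\<close>)
qed

section \<open>Identification of the left and right tangents\<close>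

lemma rot90_inner_base: "rot90 (a - c) \<bullet> (x - c) = rot90 (a - c) \<bullet> (x - a)"
proof -
  have "rot90 (a - c) \<bullet> (x - c) = rot90 (a - c) \<bullet> (x - a) + rot90 (a - c) \<bullet> (a - c)"
    unfolding inner_add_right[symmetric] by simp
  then show ?thesis by (simp only: inner_rot90_self add_0_right)
qed

lemma arc_after_eq: "arc_after K c a = {x \<in> frontier K. 0 < 1 * (rot90 (a - c) \<bullet> (x - a))}"
  unfolding arc_after_def left_side_def rot90_inner_base by auto

lemma arc_before_eq: "arc_before K c a = {x \<in> frontier K. 0 < (-1) * (rot90 (a - c) \<bullet> (x - a))}"
  unfolding arc_before_def right_side_def rot90_inner_base by auto

text \<open>Since \<open>a\<close> is a limit point of the arc, the limit is unique and the definite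
  description denotes it.\<close>

lemma right_tangent_eqI:
  assumes "c \<in> interior K" "a islimpt arc_after K c a"
    and "\<forall>c\<in>interior K. ((\<lambda>x. sgn (x - a)) \<longlongrightarrow> w) (at a within arc_after K c a)"
  shows "right_tangent K a = w"
  unfolding right_tangent_def
proof (rule the_equality)
  show "\<forall>c\<in>interior K. ((\<lambda>x. sgn (x - a)) \<longlongrightarrow> w) (at a within arc_after K c a)"
    by (rule assms(3))
next
  fix v
  assume "\<forall>c\<in>interior K. ((\<lambda>x. sgn (x - a)) \<longlongrightarrow> v) (at a within arc_after K c a)"
  then show "v = w"
    using assms by (intro tendsto_unique[of "at a within arc_after K c a" "\<lambda>x. sgn (x - a)"])
      (auto simp: trivial_limit_within)
qed

text \<open>The general limit is that of \<open>sgn (x - a)\<close>, whereas this tangent is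
  oriented along the boundary towards \<open>a\<close>; hence the sign.\<close>

lemma left_tangent_eqI:
  assumes "c \<in> interior K" "a islimpt arc_before K c a"
    and "\<forall>c\<in>interior K. ((\<lambda>x. sgn (x - a)) \<longlongrightarrow> - w) (at a within arc_before K c a)"
  shows "left_tangent K a = w"
proof -
  have "((\<lambda>x. sgn (a - x)) \<longlongrightarrow> w) (at a within arc_before K c a)" if "c \<in> interior K" for c
    using tendsto_minus[OF assms(3)[rule_format, OF that]] by (simp add: sgn_minus[symmetric])
  then have w: "\<forall>c\<in>interior K. ((\<lambda>x. sgn (a - x)) \<longlongrightarrow> w) (at a within arc_before K c a)"
    by blast
  show ?thesis
    unfolding left_tangent_def
  proof (rule the_equality)
    show "\<forall>c\<in>interior K. ((\<lambda>x. sgn (a - x)) \<longlongrightarrow> w) (at a within arc_before K c a)"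
      by (rule w)
  next
    fix v
    assume "\<forall>c\<in>interior K. ((\<lambda>x. sgn (a - x)) \<longlongrightarrow> v) (at a within arc_before K c a)"
    then show "v = w"
      using w assms(1,2)
      by (intro tendsto_unique[of "at a within arc_before K c a" "\<lambda>x. sgn (a - x)"])
        (auto simp: trivial_limit_within)
  qed
qed

text \<open>The one-sided direction is the right tangent for \<open>s = 1\<close>; for
  \<open>s = - 1\<close> it points backwards along the boundary and is the negative of the left
  tangent.\<close>

lemma tangents:
  assumes K: "convex_body K" and a: "a \<in> frontier K"
  shows norm_left_tangent: "norm (left_tangent K a) = 1"
    and norm_right_tangent: "norm (right_tangent K a) = 1"
    and left_tangent_support: "\<forall>x\<in>K. 0 \<le> rot90 (left_tangent K a) \<bullet> (x - a)"
    and right_tangent_support: "\<forall>x\<in>K. 0 \<le> rot90 (right_tangent K a) \<bullet> (x - a)"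
    and tangent_cone_interior: "\<lbrakk>0 < rot90 (left_tangent K a) \<bullet> u; 0 < rot90 (right_tangent K a) \<bullet> u\<rbrakk>
      \<Longrightarrow> \<exists>t>0. a + t *\<^sub>R u \<in> interior K"
proof -
  obtain c where c: "c \<in> interior K"
    using K by (auto simp: convex_body_def)
  obtain r where r: "norm r = 1"
    "\<forall>c\<in>interior K. ((\<lambda>x. sgn (x - a)) \<longlongrightarrow> r) (at a within arc_after K c a)"
    "\<forall>c\<in>interior K. a islimpt arc_after K c a"
    "\<forall>x\<in>K. 0 \<le> 1 * (rot90 r \<bullet> (x - a))"
    "\<forall>c\<in>interior K. \<forall>u. 0 \<le> 1 * (rot90 (a - c) \<bullet> u) \<longrightarrow> 0 < 1 * (rot90 r \<bullet> u) \<longrightarrow>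
       (\<exists>t>0. a + t *\<^sub>R u \<in> interior K)"
    using one_sided_direction[OF K a, of 1] unfolding arc_after_eq by blast
  obtain l where l: "norm l = 1"
    "\<forall>c\<in>interior K. ((\<lambda>x. sgn (x - a)) \<longlongrightarrow> l) (at a within arc_before K c a)"
    "\<forall>c\<in>interior K. a islimpt arc_before K c a"
    "\<forall>x\<in>K. 0 \<le> (-1) * (rot90 l \<bullet> (x - a))"
    "\<forall>c\<in>interior K. \<forall>u. 0 \<le> (-1) * (rot90 (a - c) \<bullet> u) \<longrightarrow> 0 < (-1) * (rot90 l \<bullet> u) \<longrightarrow>
       (\<exists>t>0. a + t *\<^sub>R u \<in> interior K)"
    using one_sided_direction[OF K a, of "-1"] unfolding arc_before_eq by blast
  have R: "right_tangent K a = r"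
    using right_tangent_eqI c r by blast
  have L: "left_tangent K a = - l"
    using left_tangent_eqI[OF c, of a "- l"] c l by simp
  show "norm (left_tangent K a) = 1" "norm (right_tangent K a) = 1"
    "\<forall>x\<in>K. 0 \<le> rot90 (left_tangent K a) \<bullet> (x - a)"
    "\<forall>x\<in>K. 0 \<le> rot90 (right_tangent K a) \<bullet> (x - a)"
    using l r by (simp_all add: L R)
  show "\<exists>t>0. a + t *\<^sub>R u \<in> interior K"
    if "0 < rot90 (left_tangent K a) \<bullet> u" "0 < rot90 (right_tangent K a) \<bullet> u"
  \<comment> \<open>On each side of the line through \<open>c\<close> and \<open>a\<close>, the
    tangent of that side alone decides.\<close>
  proof (cases "0 \<le> rot90 (a - c) \<bullet> u")
    case True
    then show ?thesis using r(5) c that(2) R by simp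
  next
    case False
    have "0 \<le> (-1) * (rot90 (a - c) \<bullet> u)" "0 < (-1) * (rot90 l \<bullet> u)"
      using False that(1) L by simp_all
    then show ?thesis using l(5) c by blast
  qed
qed

subsection \<open>Rotations about a common point of the sectors\<close>

text \<open>The coefficients \<open>c\<close> and \<open>s\<close> are the cosine and sine of the
  angle; this form replaces matrices from here on.\<close>

lemma isom_plus_iff:
  "f \<in> isom_plus \<longleftrightarrow> (\<exists>c s b. c\<^sup>2 + s\<^sup>2 = 1 \<and> f = (\<lambda>x. c *\<^sub>R x + s *\<^sub>R rot90 x + b))"
proof
  assume "f \<in> isom_plus"
  then obtain A b where A: "rotation_matrix A" and f: "f = (\<lambda>x. A *v x + b)"
    by (auto simp: isom_plus_def)
  have "transpose A ** A = mat 1"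
    using A by (simp add: rotation_matrix_def orthogonal_matrix_def)
  then have 1: "A $ 1 $ 1 * A $ 1 $ 1 + A $ 2 $ 1 * A $ 2 $ 1 = 1"
      "A $ 1 $ 2 * A $ 1 $ 2 + A $ 2 $ 2 * A $ 2 $ 2 = 1"
    by (simp_all add: vec_eq_iff forall_2 matrix_matrix_mult_def sum_2 transpose_def mat_def)
  have "A $ 1 $ 1 * A $ 2 $ 2 - A $ 1 $ 2 * A $ 2 $ 1 = 1"
    using A by (simp add: rotation_matrix_def det_2)
  \<comment> \<open>Columns of length 1 and determinant 1 make the sum of squares equal to 1 + 1 -
    2.\<close>
  with 1 have "(A $ 1 $ 1 - A $ 2 $ 2)\<^sup>2 + (A $ 2 $ 1 + A $ 1 $ 2)\<^sup>2 = 0"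
    by (simp add: power2_eq_square algebra_simps)
  then have 2: "A $ 2 $ 2 = A $ 1 $ 1" "A $ 1 $ 2 = - A $ 2 $ 1"
    by (simp_all add: sum_power2_eq_zero_iff)
  have "f = (\<lambda>x. A $ 1 $ 1 *\<^sub>R x + A $ 2 $ 1 *\<^sub>R rot90 x + b)"
    unfolding f by (rule ext) (simp add: vec_eq_iff forall_2 matrix_vector_mult_def sum_2 2)
  then show "\<exists>c s b. c\<^sup>2 + s\<^sup>2 = 1 \<and> f = (\<lambda>x. c *\<^sub>R x + s *\<^sub>R rot90 x + b)"
    using 1(1)
    by (intro exI[of _ "A $ 1 $ 1"] exI[of _ "A $ 2 $ 1"] exI[of _ b]) (simp add: power2_eq_square)
next
  assume "\<exists>c s b. c\<^sup>2 + s\<^sup>2 = 1 \<and> f = (\<lambda>x. c *\<^sub>R x + s *\<^sub>R rot90 x + b)"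
  then obtain c s b where cs: "c\<^sup>2 + s\<^sup>2 = 1" and f: "f = (\<lambda>x. c *\<^sub>R x + s *\<^sub>R rot90 x + b)"
    by blast
  define A :: "real^2^2" where "A = vector [vector [c, - s], vector [s, c]]"
  have "rotation_matrix A"
    using cs unfolding rotation_matrix_def orthogonal_matrix_def det_2
    by (simp add: A_def vec_eq_iff forall_2 matrix_matrix_mult_def sum_2 transpose_def mat_def
        power2_eq_square algebra_simps)
  moreover have "f = (\<lambda>x. A *v x + b)"
    unfolding f by (rule ext) (simp add: A_def vec_eq_iff forall_2 matrix_vector_mult_def sum_2)
  ultimately show "f \<in> isom_plus"
    by (auto simp: isom_plus_def)
qed

text \<open>For \<open>q = a - p\<close>, this is the height, over the line through \<open>a\<close>
  of direction \<open>v\<close>, of the image of \<open>a\<close> under the rotation about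
  \<open>p\<close> by \<open>- \<sigma> * \<theta>\<close>. It vanishes at 0 with negative
  derivative.\<close>

lemma rotation_moves_outside:
  fixes q v :: plane
  assumes "0 < \<sigma> * (v \<bullet> q)"
  shows "\<forall>\<^sub>F \<theta> in at_right 0. (cos \<theta> - 1) * (rot90 v \<bullet> q) - \<sigma> * sin \<theta> * (v \<bullet> q) < 0"
proof -
  define g where "g \<theta> = (cos \<theta> - 1) * (rot90 v \<bullet> q) - \<sigma> * sin \<theta> * (v \<bullet> q)" for \<theta>
  have "(g has_real_derivative - (\<sigma> * (v \<bullet> q))) (at 0)"
    unfolding g_def by (auto intro!: derivative_eq_intros)
  then obtain e where "0 < e" "\<forall>h>0. h < e \<longrightarrow> g h < g 0"
    using DERIV_neg_dec_right[of g "- (\<sigma> * (v \<bullet> q))" 0] assms by auto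
  then have "\<forall>\<^sub>F \<theta> in at_right 0. g \<theta> < g 0"
    by (auto simp: eventually_at_right_field)
  then show ?thesis
    by (simp add: g_def)
qed

text \<open>Rotate \<open>K\<close> about \<open>p\<close> in the sense given by
  \<open>\<sigma>\<close>. A point \<open>a i\<close> lies in the rotated body only if its backward
  rotation lies in \<open>K\<close>, but for small positive angles that image is behind a supporting
  line.\<close>

lemma not_weakly_fixing_if_rotation_center:
  assumes n: "1 \<le> n" and a: "\<And>i. i \<in> {1..n} \<Longrightarrow> a i \<in> K" and \<sigma>: "\<sigma> = 1 \<or> \<sigma> = - 1"
    and v: "\<And>i. i \<in> {1..n} \<Longrightarrow>
      \<exists>v. (\<forall>x\<in>K. 0 \<le> rot90 v \<bullet> (x - a i)) \<and> 0 < \<sigma> * (v \<bullet> (a i - p))"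
  shows "\<not> weakly_fixing K n a"
proof -
  obtain v where v: "\<And>i. i \<in> {1..n} \<Longrightarrow> \<forall>x\<in>K. 0 \<le> rot90 (v i) \<bullet> (x - a i)"
     "\<And>i. i \<in> {1..n} \<Longrightarrow> 0 < \<sigma> * (v i \<bullet> (a i - p))"
    using v by metis
  define g where "g i \<theta> = (cos \<theta> - 1) * (rot90 (v i) \<bullet> (a i - p)) - \<sigma> * sin \<theta> * (v i \<bullet> (a i - p))" for i \<theta>
  have "\<forall>\<^sub>F \<theta> in at_right 0. \<forall>i\<in>{1..n}. g i \<theta> < 0"
    unfolding g_def using v(2) by (intro eventually_ball_finite ballI rotation_moves_outside) auto
  then obtain e where e: "0 < e" "\<And>\<theta>. 0 < \<theta> \<Longrightarrow> \<theta> < e \<Longrightarrow> \<forall>i\<in>{1..n}. g i \<theta> < 0"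
    unfolding eventually_at_right_field by blast
  define \<rho> where "\<rho> \<theta> x = cos \<theta> *\<^sub>R x + (\<sigma> * sin \<theta>) *\<^sub>R rot90 x
      + (p - cos \<theta> *\<^sub>R p - (\<sigma> * sin \<theta>) *\<^sub>R rot90 p)" for \<theta> x
  have s2: "\<sigma> * \<sigma> = 1" using \<sigma> by auto
  have iso: "\<rho> \<theta> \<in> isom_plus" for \<theta>
    unfolding isom_plus_iff \<rho>_def
    by (intro exI conjI) (auto simp: power_mult_distrib power2_eq_square[of \<sigma>] s2)
  have out: "a i \<notin> \<rho> \<theta> ` K" if i: "i \<in> {1..n}" and \<theta>: "0 < \<theta>" "\<theta> < e" for i \<theta>
  proof
    assume "a i \<in> \<rho> \<theta> ` K"
    then obtain y where y: "y \<in> K" "a i = \<rho> \<theta> y" by blast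
    define z where "z = y - p"
    have q: "a i - p = cos \<theta> *\<^sub>R z + (\<sigma> * sin \<theta>) *\<^sub>R rot90 z"
      unfolding y(2) \<rho>_def z_def by (simp add: algebra_simps)
    have cs: "cos \<theta> * cos \<theta> + (\<sigma> * sin \<theta>) * (\<sigma> * sin \<theta>) = 1"
    proof -
      have "cos \<theta> * cos \<theta> + (\<sigma> * sin \<theta>) * (\<sigma> * sin \<theta>) = (cos \<theta>)\<^sup>2 + (\<sigma> * \<sigma>) * (sin \<theta>)\<^sup>2"
        by (simp add: power2_eq_square algebra_simps)
      then show ?thesis by (simp add: s2)
    qed
    have "cos \<theta> *\<^sub>R (a i - p) - (\<sigma> * sin \<theta>) *\<^sub>R rot90 (a i - p)
       = (cos \<theta> * cos \<theta> + (\<sigma> * sin \<theta>) * (\<sigma> * sin \<theta>)) *\<^sub>R z"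
      unfolding q by (simp add: algebra_simps)
    then have z: "z = cos \<theta> *\<^sub>R (a i - p) - (\<sigma> * sin \<theta>) *\<^sub>R rot90 (a i - p)"
      unfolding cs by simp
    have "y - a i = z - (a i - p)" by (simp add: z_def)
    also have "\<dots> = (cos \<theta> - 1) *\<^sub>R (a i - p) - (\<sigma> * sin \<theta>) *\<^sub>R rot90 (a i - p)"
      unfolding z by (simp only: scaleR_left_diff_distrib) simp
    finally have "rot90 (v i) \<bullet> (y - a i)
        = (cos \<theta> - 1) * (rot90 (v i) \<bullet> (a i - p)) - (\<sigma> * sin \<theta>) * (rot90 (v i) \<bullet> rot90 (a i - p))"
      by (simp only: inner_diff_right inner_scaleR_right)
    also have "\<dots> = g i \<theta>"
      by (simp only: inner_rot90_rot90 g_def)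
    finally show False
      using e(2)[OF \<theta>] i v(1)[OF i] y(1) by fastforce
  qed
  \<comment> \<open>Stopping at \<open>e / 2\<close> keeps all angles at positive times strictly
    between 0 and \<open>e\<close>.\<close>
  define \<gamma> where "\<gamma> t = \<rho> (t * (e / 2))" for t
  have "path \<gamma>"
    unfolding path_def \<gamma>_def \<rho>_def
    by (intro continuous_on_coordinatewise_then_product continuous_intros)
  moreover have "path_image \<gamma> \<subseteq> isom_plus"
    using iso by (auto simp: path_image_def \<gamma>_def)
  moreover have "\<gamma> 0 ` K = K"
    by (simp add: \<gamma>_def \<rho>_def)
  \<comment> \<open>\<open>a 1\<close> belongs to \<open>K\<close> but not to the rotated
    body.\<close>
  moreover have "\<gamma> 1 ` K \<noteq> K"
    using out[of 1 "e / 2"] a[of 1] n e(1) by (auto simp: \<gamma>_def)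
  moreover have "a i \<notin> interior (\<gamma> t ` K)" if i: "i \<in> {1..n}" and t: "t \<in> {0..1}" for i t
  proof (cases "t = 0")
    case True
    have "0 \<noteq> v i" using v(2)[OF i] by auto
    then have "rot90 (v i) \<noteq> 0" by simp
    then have "a i \<notin> interior K"
      using support_pos[OF v(1)[OF i], of "a i"] by auto
    then show ?thesis
      using True \<open>\<gamma> 0 ` K = K\<close> by simp
  next
    case False
    have "t * (e / 2) \<le> 1 * (e / 2)"
      using t e(1) by (intro mult_right_mono) auto
    then have "a i \<notin> \<gamma> t ` K"
      unfolding \<gamma>_def using False t e(1) i by (intro out) auto
    then show ?thesis
      using interior_subset by blast
  qed
  ultimately show ?thesis
    unfolding weakly_fixing_def by blast
qed

text \<open>This excludes the empty family, for which the intersections of sectors are the whole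
  plane. A translation moves \<open>K\<close>, since it pushes a point of maximal first coordinate
  out of \<open>K\<close>.\<close>

lemma not_weakly_fixing_0:
  assumes "convex_body K"
  shows "\<not> weakly_fixing K 0 a"
proof -
  define e :: plane where "e = axis 1 1"
  define \<gamma> :: "real \<Rightarrow> plane \<Rightarrow> plane" where "\<gamma> t x = 1 *\<^sub>R x + 0 *\<^sub>R rot90 x + t *\<^sub>R e" for t x
  have "path \<gamma>"
    unfolding path_def \<gamma>_def
    by (intro continuous_on_coordinatewise_then_product continuous_intros)
  moreover have "path_image \<gamma> \<subseteq> isom_plus"
  proof -
    have "\<gamma> t \<in> isom_plus" for t
      unfolding isom_plus_iff \<gamma>_def
      by (rule exI[of _ 1], rule exI[of _ 0], rule exI[of _ "t *\<^sub>R e"]) simp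
    then show ?thesis
      by (auto simp: path_image_def)
  qed
  moreover have "\<gamma> 1 ` K \<noteq> K"
  proof
    assume eq: "\<gamma> 1 ` K = K"
    have "compact K" "K \<noteq> {}"
      using assms by (auto simp: convex_body_def)
    then obtain x where x: "x \<in> K" "\<forall>y\<in>K. e \<bullet> y \<le> e \<bullet> x"
      using continuous_attains_sup[OF _ _ continuous_on_inner[OF continuous_on_const continuous_on_id]]
      by metis
    have "\<gamma> 1 x \<in> K" using x(1) eq by blast
    with x(2) have "e \<bullet> \<gamma> 1 x \<le> e \<bullet> x" by blast
    then show False
      by (simp add: \<gamma>_def inner_add_right e_def)
  qed
  moreover have "\<gamma> 0 ` K = K"
    by (simp add: \<gamma>_def)
  ultimately show ?thesis
    unfolding weakly_fixing_def not_all by (intro exI[of _ \<gamma>]) simp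
qed

subsection \<open>Infinitesimal isometries\<close>

lemma norm_rotation:
  assumes "c\<^sup>2 + s\<^sup>2 = 1"
  shows "norm (c *\<^sub>R x + s *\<^sub>R rot90 x) = norm x"
proof -
  have "(c *\<^sub>R x + s *\<^sub>R rot90 x) \<bullet> (c *\<^sub>R x + s *\<^sub>R rot90 x) = (c\<^sup>2 + s\<^sup>2) * (x \<bullet> x)"
    by (simp add: inner_add_left inner_add_right power2_eq_square algebra_simps)
  then show ?thesis
    using assms by (simp add: norm_eq_sqrt_inner)
qed

lemma rotation_inverse:
  assumes "c\<^sup>2 + s\<^sup>2 = 1"
  shows "c *\<^sub>R (c *\<^sub>R x + s *\<^sub>R rot90 x) - s *\<^sub>R rot90 (c *\<^sub>R x + s *\<^sub>R rot90 x) = x"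
proof -
  have "c *\<^sub>R (c *\<^sub>R x + s *\<^sub>R rot90 x) - s *\<^sub>R rot90 (c *\<^sub>R x + s *\<^sub>R rot90 x) = (c\<^sup>2 + s\<^sup>2) *\<^sub>R x"
    by (simp add: power2_eq_square algebra_simps)
  with assms show ?thesis by simp
qed

text \<open>Passing to the inverse isometry keeps \<open>K\<close> still and moves the points
  instead.\<close>

lemma not_fixing_small_isometry:
  fixes K :: "plane set"
  assumes nf: "\<not> fixing K n a" and e: "0 < e"
  obtains c s b where "c\<^sup>2 + s\<^sup>2 = 1" "\<bar>c - 1\<bar> < e" "\<bar>s\<bar> < e" "norm b < e"
    "(c - 1, s, b) \<noteq> 0" "\<forall>i\<in>{1..n}. c *\<^sub>R a i + s *\<^sub>R rot90 (a i) + b \<notin> interior K"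
proof -
  define e1 :: plane where "e1 = axis 1 1"
  \<comment> \<open>\<open>f 0\<close> is the translation part, and \<open>f e1 - f 0 - e1\<close>
    has the coordinates \<open>c - 1\<close> and \<open>s\<close>.\<close>
  define T where "T = {f :: plane \<Rightarrow> plane. norm (f 0) < e \<and> norm (f e1 - f 0 - e1) < e}"
  have ev: "continuous_on UNIV (\<lambda>f :: plane \<Rightarrow> plane. f x)" for x
    by simp
  have "open T"
    unfolding T_def by (intro open_Collect_conj open_Collect_less continuous_intros ev)
  then have "openin (top_of_set isom_plus) (isom_plus \<inter> T)"
    by (rule openin_open_Int)
  moreover have "id \<in> isom_plus \<inter> T"
  proof -
    have "id \<in> isom_plus"
      unfolding isom_plus_iff
      by (rule exI[of _ 1], rule exI[of _ 0], rule exI[of _ 0]) auto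
    then show ?thesis
      using e by (simp add: T_def)
  qed
  ultimately obtain f where f: "f \<in> isom_plus" "f \<in> T" "f ` K \<noteq> K"
    and out: "\<forall>i\<in>{1..n}. a i \<notin> interior (f ` K)"
    using nf unfolding fixing_def by (meson IntD1 IntD2)
  obtain c s b where cs: "c\<^sup>2 + s\<^sup>2 = 1" and fx: "f = (\<lambda>x. c *\<^sub>R x + s *\<^sub>R rot90 x + b)"
    using f(1) unfolding isom_plus_iff by blast
  have cs': "c\<^sup>2 + (- s)\<^sup>2 = 1" using cs by simp
  define b' where "b' = - (c *\<^sub>R b - s *\<^sub>R rot90 b)"
  define g where "g x = c *\<^sub>R x + (- s) *\<^sub>R rot90 x + b'" for x
  have gf: "g (f x) = x" for x
    using rotation_inverse[OF cs, of x] unfolding g_def fx b'_def by (simp add: algebra_simps)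
  have fg: "f (g x) = x" for x
  proof -
    have "f (g x) = (c *\<^sub>R (c *\<^sub>R x + (- s) *\<^sub>R rot90 x) - (- s) *\<^sub>R rot90 (c *\<^sub>R x + (- s) *\<^sub>R rot90 x))
      - (c *\<^sub>R (c *\<^sub>R b + (- s) *\<^sub>R rot90 b) - (- s) *\<^sub>R rot90 (c *\<^sub>R b + (- s) *\<^sub>R rot90 b)) + b"
      unfolding g_def fx b'_def by (simp add: algebra_simps)
    then show ?thesis
      unfolding rotation_inverse[OF cs'] by simp
  qed
  have e1: "(f e1 - f 0 - e1) $ 1 = c - 1" "(f e1 - f 0 - e1) $ 2 = s"
    by (simp_all add: fx e1_def axis_def)
  show thesis
  proof (rule that)
    show "c\<^sup>2 + (- s)\<^sup>2 = 1" by (rule cs')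
    have "norm (f e1 - f 0 - e1) < e" using f(2) by (simp add: T_def)
    then show "\<bar>c - 1\<bar> < e" "\<bar>- s\<bar> < e"
      using component_le_norm_cart[of "f e1 - f 0 - e1" 1]
        component_le_norm_cart[of "f e1 - f 0 - e1" 2] unfolding e1 by auto
    have "norm b' = norm b"
      using norm_rotation[OF cs', of b] unfolding b'_def norm_minus_cancel by simp
    then show "norm b' < e"
      using f(2) by (simp add: T_def fx)
    show "(c - 1, - s, b') \<noteq> 0"
    proof
      assume "(c - 1, - s, b') = 0"
      then have "g x = x" for x
        by (simp add: g_def zero_prod_def)
      then have "f x = x" for x
        using gf by metis
      then show False
        using f(3) by simp
    qed
    show "\<forall>i\<in>{1..n}. c *\<^sub>R a i + (- s) *\<^sub>R rot90 (a i) + b' \<notin> interior K"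
    proof
      fix i assume i: "i \<in> {1..n}"
      have "a i \<in> interior (f ` K)" if "g (a i) \<in> interior K"
      proof (rule interiorI)
        show "open (g -` interior K)"
          unfolding g_def by (intro open_vimage open_interior continuous_intros)
        show "a i \<in> g -` interior K" using that by simp
        show "g -` interior K \<subseteq> f ` K"
          using fg interior_subset by (metis image_eqI subsetD subsetI vimageD)
      qed
      with out i show "c *\<^sub>R a i + (- s) *\<^sub>R rot90 (a i) + b' \<notin> interior K"
        by (auto simp: g_def)
    qed
  qed
qed

text \<open>
  Normalising the displacement fields of isometries that tend to the identity yields in the limit a
  nonzero infinitesimal isometry \<open>x \<mapsto> \<omega> *\<^sub>R rot90 x + \<beta>\<close>; the component \<open>cos - 1\<close> disappears
  because it is of second order.
\<close>

lemma not_fixing_infinitesimal: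
  fixes K :: "plane set"
  assumes K: "convex K" and aK: "\<And>i. i \<in> {1..n} \<Longrightarrow> a i \<in> K" and nf: "\<not> fixing K n a"
  obtains \<omega> \<beta> where "\<omega> \<noteq> 0 \<or> \<beta> \<noteq> 0"
    "\<And>i t. i \<in> {1..n} \<Longrightarrow> 0 < t \<Longrightarrow> a i + t *\<^sub>R (\<omega> *\<^sub>R rot90 (a i) + \<beta>) \<notin> interior K"
proof -
  have "\<exists>c s b. c\<^sup>2 + s\<^sup>2 = 1 \<and> \<bar>c - 1\<bar> < inverse (real (Suc k)) \<and> \<bar>s\<bar> < inverse (real (Suc k))
    \<and> norm b < inverse (real (Suc k)) \<and> (c - 1, s, b) \<noteq> 0
    \<and> (\<forall>i\<in>{1..n}. c *\<^sub>R a i + s *\<^sub>R rot90 (a i) + b \<notin> interior K)" for k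
    by (rule not_fixing_small_isometry[OF nf, of "inverse (real (Suc k))"]) (simp, blast)
  then obtain c s b where cs: "\<And>k. (c k)\<^sup>2 + (s k)\<^sup>2 = 1"
    and small: "\<And>k. \<bar>c k - 1\<bar> < inverse (real (Suc k))" "\<And>k. \<bar>s k\<bar> < inverse (real (Suc k))"
      "\<And>k. norm (b k) < inverse (real (Suc k))"
    and nz: "\<And>k. (c k - 1, s k, b k) \<noteq> 0"
    and out: "\<And>k i. i \<in> {1..n} \<Longrightarrow> c k *\<^sub>R a i + s k *\<^sub>R rot90 (a i) + b k \<notin> interior K"
    by metis
  \<comment> \<open>The parameters of the displacement; normalised, they lie on a compact unit
    sphere, so a subsequence converges.\<close>
  define z where "z k = (c k - 1, s k, b k)" for k
  have null: "f \<longlonglongrightarrow> 0" if "\<And>k. norm (f k) < inverse (real (Suc k))" for f :: "nat \<Rightarrow> 'b::real_normed_vector"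
    using that by (intro Lim_null_comparison[OF _ LIMSEQ_inverse_real_of_nat] always_eventually)
      (auto intro: less_imp_le)
  have lim: "(\<lambda>k. c k - 1) \<longlonglongrightarrow> 0" "s \<longlonglongrightarrow> 0" "b \<longlonglongrightarrow> 0"
    using small by (auto intro!: null simp del: of_nat_Suc)
  have "z \<longlonglongrightarrow> (0, 0, 0)"
    unfolding z_def by (intro tendsto_intros lim)
  then have N0: "(\<lambda>k. norm (z k)) \<longlonglongrightarrow> 0"
    by (intro tendsto_norm_zero) (simp add: zero_prod_def)
  have zpos: "0 < norm (z k)" for k
    using nz by (simp add: z_def)
  have sph: "\<forall>k. sgn (z k) \<in> sphere 0 1"
    using zpos by (auto simp: norm_sgn)
  obtain l r where l: "l \<in> sphere 0 1" and r: "strict_mono r"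
    and lr: "((\<lambda>k. sgn (z k)) \<circ> r) \<longlonglongrightarrow> l"
    by (rule seq_compactE[OF compact_imp_seq_compact[OF compact_sphere] sph])
  obtain \<alpha> \<omega> \<beta> where l_eq: "l = (\<alpha>, \<omega>, \<beta>)"
    by (metis prod.exhaust)
  define x where "x k = fst (sgn (z (r k)))" for k
  define y where "y k = fst (snd (sgn (z (r k))))" for k
  define w where "w k = snd (snd (sgn (z (r k))))" for k
  have xyw: "x \<longlonglongrightarrow> \<alpha>" "y \<longlonglongrightarrow> \<omega>" "w \<longlonglongrightarrow> \<beta>"
    using tendsto_fst[OF lr] tendsto_fst[OF tendsto_snd[OF lr]] tendsto_snd[OF tendsto_snd[OF lr]]
    unfolding x_def y_def w_def by (simp_all add: l_eq o_def)
  define N where "N = (\<lambda>k. norm (z (r k)))"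
  have Npos: "0 < N k" for k
    using zpos by (simp add: N_def)
  have N_lim: "N \<longlonglongrightarrow> 0"
    using LIMSEQ_subseq_LIMSEQ[OF N0 r] by (simp add: N_def o_def)
  have scale: "c (r k) - 1 = N k * x k" "s (r k) = N k * y k" "b (r k) = N k *\<^sub>R w k" for k
  proof -
    have "z (r k) = N k *\<^sub>R sgn (z (r k))"
      using zpos[of "r k"] by (simp add: N_def sgn_div_norm)
    then show "c (r k) - 1 = N k * x k" "s (r k) = N k * y k" "b (r k) = N k *\<^sub>R w k"
      by (metis fst_conv snd_conv fst_scaleR snd_scaleR real_scaleR_def x_def y_def w_def z_def)+
  qed
  have "\<alpha> = 0"
  proof -
    \<comment> \<open>The relation between \<open>c\<close> and \<open>s\<close>, written in the
      scaled parameters. Divided by \<open>N k\<close>, it leaves \<open>2 * x k\<close> plus null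
      sequences.\<close>
    have "N k * (x k * (c (r k) - 1) + y k * s (r k) + 2 * x k) = 0" for k
    proof -
      have "N k * (x k * (c (r k) - 1) + y k * s (r k) + 2 * x k)
        = (c (r k) - 1) * (c (r k) - 1) + s (r k) * s (r k) + 2 * (c (r k) - 1)"
        by (simp add: scale algebra_simps)
      also have "\<dots> = (c (r k))\<^sup>2 + (s (r k))\<^sup>2 - 1"
        by (simp add: power2_eq_square algebra_simps)
      finally show ?thesis by (simp add: cs)
    qed
    then have "x k * (c (r k) - 1) + y k * s (r k) + 2 * x k = 0" for k
      using Npos[of k] by (metis less_irrefl mult_eq_0_iff)
    then have "(\<lambda>k. x k * (c (r k) - 1) + y k * s (r k) + 2 * x k) = (\<lambda>k. 0)"
      by (rule ext)
    moreover have "(\<lambda>k. x k * (c (r k) - 1) + y k * s (r k) + 2 * x k) \<longlonglongrightarrow> \<alpha> * 0 + \<omega> * 0 + 2 * \<alpha>"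
      using LIMSEQ_subseq_LIMSEQ[OF lim(1) r] LIMSEQ_subseq_LIMSEQ[OF lim(2) r]
      by (intro tendsto_intros xyw) (simp_all add: o_def)
    ultimately have "(\<lambda>k::nat. 0) \<longlonglongrightarrow> \<alpha> * 0 + \<omega> * 0 + 2 * \<alpha>"
      by (simp only:)
    then show ?thesis
      by (simp add: LIMSEQ_const_iff)
  qed
  show thesis
  proof (rule that[of \<omega> \<beta>])
    show "\<omega> \<noteq> 0 \<or> \<beta> \<noteq> 0"
      using l \<open>\<alpha> = 0\<close> by (auto simp: l_eq zero_prod_def[symmetric])
    fix i t
    assume i: "i \<in> {1..n}" and t: "(0::real) < t"
    define u where "u k = x k *\<^sub>R a i + y k *\<^sub>R rot90 (a i) + w k" for k
    have "(\<lambda>k. a i + t *\<^sub>R u k) \<longlonglongrightarrow> a i + t *\<^sub>R (\<alpha> *\<^sub>R a i + \<omega> *\<^sub>R rot90 (a i) + \<beta>)"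
      unfolding u_def by (intro tendsto_intros xyw)
    then have u_lim: "(\<lambda>k. a i + t *\<^sub>R u k) \<longlonglongrightarrow> a i + t *\<^sub>R (\<omega> *\<^sub>R rot90 (a i) + \<beta>)"
      by (simp add: \<open>\<alpha> = 0\<close>)
    show "a i + t *\<^sub>R (\<omega> *\<^sub>R rot90 (a i) + \<beta>) \<notin> interior K"
    proof
      assume "a i + t *\<^sub>R (\<omega> *\<^sub>R rot90 (a i) + \<beta>) \<in> interior K"
      then have "\<forall>\<^sub>F k in sequentially. a i + t *\<^sub>R u k \<in> interior K"
        using u_lim by (intro topological_tendstoD) auto
      moreover have "\<forall>\<^sub>F k in sequentially. N k < t"
        using order_tendstoD(2)[OF N_lim t] .
      ultimately have "\<forall>\<^sub>F k in sequentially. a i + t *\<^sub>R u k \<in> interior K \<and> N k < t"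
        by (rule eventually_conj)
      then obtain k where k: "a i + t *\<^sub>R u k \<in> interior K" "N k < t"
        using eventually_happens'[OF sequentially_bot] by blast
      \<comment> \<open>For \<open>N k < t\<close> the actual image
        \<open>a i + N k *\<^sub>R u k\<close> lies between \<open>a i\<close> and an interior
        point, so it is interior.\<close>
      have "a i + 0 *\<^sub>R (a i - a i) + (N k / t) *\<^sub>R (a i + t *\<^sub>R u k - a i) \<in> interior K"
        using k t Npos[of k] by (intro interior_convex_combination[OF K aK aK k(1)] i) auto
      then have "a i + N k *\<^sub>R u k \<in> interior K"
        using t by simp
      moreover have "a i + N k *\<^sub>R u k = c (r k) *\<^sub>R a i + s (r k) *\<^sub>R rot90 (a i) + b (r k)"
      proof -
        have "c (r k) = 1 + N k * x k" using scale(1)[of k] by simp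
        then show ?thesis
          by (simp add: scale u_def algebra_simps)
      qed
      ultimately show False
        using out[OF i] by metis
    qed
  qed
qed

section \<open>Sectors in terms of the tangents, and the sufficient condition\<close>

lemma closure_left_side:
  assumes "d \<noteq> 0"
  shows "closure (left_side p (rot90 d)) = {x. d \<bullet> (x - p) \<le> 0}"
proof -
  have "left_side p (rot90 d) = {x. d \<bullet> x < d \<bullet> p}"
    by (auto simp: left_side_def inner_diff_right)
  then show ?thesis
    using assms by (auto simp: inner_diff_right)
qed

lemma closure_right_side:
  assumes "d \<noteq> 0"
  shows "closure (right_side p (rot90 d)) = {x. 0 \<le> d \<bullet> (x - p)}"
proof -
  have "right_side p (rot90 d) = {x. d \<bullet> x > d \<bullet> p}"
    by (auto simp: right_side_def inner_diff_right)
  then show ?thesis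
    using assms by (auto simp: inner_diff_right)
qed

lemma sectors:
  assumes "convex_body K" "a \<in> frontier K"
  shows mem_L_sector: "p \<in> L_sector K a \<longleftrightarrow>
      0 < left_tangent K a \<bullet> (a - p) \<or> 0 < right_tangent K a \<bullet> (a - p)"
    and mem_R_sector: "p \<in> R_sector K a \<longleftrightarrow>
      left_tangent K a \<bullet> (a - p) < 0 \<or> right_tangent K a \<bullet> (a - p) < 0"
    and mem_closure_L_sector: "p \<in> closure (L_sector K a) \<longleftrightarrow>
      left_tangent K a \<bullet> (p - a) \<le> 0 \<or> right_tangent K a \<bullet> (p - a) \<le> 0"
    and mem_closure_R_sector: "p \<in> closure (R_sector K a) \<longleftrightarrow>
      0 \<le> left_tangent K a \<bullet> (p - a) \<or> 0 \<le> right_tangent K a \<bullet> (p - a)"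
proof -
  have "left_tangent K a \<noteq> 0" "right_tangent K a \<noteq> 0"
    using norm_left_tangent[OF assms] norm_right_tangent[OF assms] by auto
  then show "p \<in> closure (L_sector K a) \<longleftrightarrow>
      left_tangent K a \<bullet> (p - a) \<le> 0 \<or> right_tangent K a \<bullet> (p - a) \<le> 0"
    "p \<in> closure (R_sector K a) \<longleftrightarrow>
      0 \<le> left_tangent K a \<bullet> (p - a) \<or> 0 \<le> right_tangent K a \<bullet> (p - a)"
    by (simp_all add: L_sector_def R_sector_def left_normal_def right_normal_def
        closure_left_side closure_right_side)
qed (auto simp: L_sector_def R_sector_def left_side_def right_side_def left_normal_def
    right_normal_def inner_diff_right)

lemma fixing_if_closed_sectors_disjoint:
  assumes K: "convex_body K" and a: "\<And>i. i \<in> {1..n} \<Longrightarrow> a i \<in> frontier K"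
    and L: "(\<Inter>i\<in>{1..n}. closure (L_sector K (a i))) = {}"
    and R: "(\<Inter>i\<in>{1..n}. closure (R_sector K (a i))) = {}"
    and D: "(\<Inter>i\<in>{1..n}. L_directions K (a i)) = {}"
  shows "fixing K n a"
proof (rule ccontr)
  assume nf: "\<not> fixing K n a"
  have cK: "convex K" "closed K"
    using K by (auto simp: convex_body_def compact_imp_closed)
  have aK: "a i \<in> K" if "i \<in> {1..n}" for i
    using a[OF that] cK by (simp add: frontier_def)
  obtain \<omega> \<beta> where nz: "\<omega> \<noteq> 0 \<or> \<beta> \<noteq> 0"
    and out: "\<And>i t. i \<in> {1..n} \<Longrightarrow> 0 < t \<Longrightarrow> a i + t *\<^sub>R (\<omega> *\<^sub>R rot90 (a i) + \<beta>) \<notin> interior K"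
    using not_fixing_infinitesimal[of K n a, OF cK(1) aK nf] by blast
  \<comment> \<open>A displacement strictly to the left of both tangents would lead into the
    interior.\<close>
  have dir: "rot90 (left_tangent K (a i)) \<bullet> (\<omega> *\<^sub>R rot90 (a i) + \<beta>) \<le> 0
      \<or> rot90 (right_tangent K (a i)) \<bullet> (\<omega> *\<^sub>R rot90 (a i) + \<beta>) \<le> 0" if i: "i \<in> {1..n}" for i
    using tangent_cone_interior[OF K a[OF i], of "\<omega> *\<^sub>R rot90 (a i) + \<beta>"] out[OF i]
    by (meson not_le)
  show False
  proof (cases "\<omega> = 0")
    case False
    \<comment> \<open>The zero of the displacement field, that is, the centre of the infinitesimal
      rotation.\<close>
    define p where "p = (1 / \<omega>) *\<^sub>R rot90 \<beta>"
    have "\<omega> *\<^sub>R rot90 (x - p) = \<omega> *\<^sub>R rot90 x + \<beta>" for x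
      using False by (simp add: p_def algebra_simps)
    then have "rot90 v \<bullet> (\<omega> *\<^sub>R rot90 x + \<beta>) = \<omega> * (v \<bullet> (x - p))" for v x
      by (metis inner_rot90_rot90 inner_scaleR_right)
    then have *: "rot90 v \<bullet> (\<omega> *\<^sub>R rot90 x + \<beta>) = - \<omega> * (v \<bullet> (p - x))" for v x
      by (simp add: inner_diff_right algebra_simps)
    show False
    proof (cases "0 < \<omega>")
      case True
      then have "\<forall>i\<in>{1..n}. p \<in> closure (R_sector K (a i))"
        using dir K a unfolding * by (auto simp: mem_closure_R_sector zero_le_mult_iff)
      with R show False by blast
    next
      case neg: False
      then have "\<forall>i\<in>{1..n}. p \<in> closure (L_sector K (a i))"
        using dir K a False unfolding * by (auto simp: mem_closure_L_sector mult_le_0_iff zero_le_mult_iff)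
      with L show False by blast
    qed
  next
    case True
    with nz have b: "\<beta> \<noteq> 0" by simp
    \<comment> \<open>\<open>\<beta>\<close> turned clockwise by a right angle and normalised, so
      that \<open>v \<bullet> x\<close> has the sign of
      \<open>rot90 v \<bullet> \<beta>\<close>.\<close>
    define x where "x = - sgn (rot90 \<beta>)"
    have "norm x = 1" using b by (simp add: x_def norm_sgn)
    have x: "v \<bullet> x = (rot90 v \<bullet> \<beta>) / norm \<beta>" for v
      by (simp add: x_def sgn_div_norm inner_rot90_left divide_inverse)
    have "\<forall>i\<in>{1..n}. x \<in> L_directions K (a i)"
      using dir True b K a \<open>norm x = 1\<close>
      by (auto simp: L_directions_def mem_closure_L_sector x divide_le_0_iff)
    with D show False by blast
  qed
qed

section \<open>Deduction of the necessary and the sufficient condition\<close>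

theorem theorem4:
  fixes K :: "plane set" and n :: nat and a :: "nat \<Rightarrow> plane"
  assumes "convex_body K"
    and "\<And>i. i \<in> {1..n} \<Longrightarrow> a i \<in> frontier K"
  shows "(weakly_fixing K n a \<longrightarrow>
            (\<Inter>i\<in>{1..n}. L_sector K (a i)) = {} \<and>
            (\<Inter>i\<in>{1..n}. R_sector K (a i)) = {}) \<and>
         ((\<Inter>i\<in>{1..n}. closure (L_sector K (a i))) = {} \<and>
          (\<Inter>i\<in>{1..n}. closure (R_sector K (a i))) = {} \<and>
          (\<Inter>i\<in>{1..n}. L_directions K (a i)) = {} \<longrightarrow>
            fixing K n a)"
proof (intro conjI impI)
  have aK: "a i \<in> K" if "i \<in> {1..n}" for i
    using assms(1) assms(2)[OF that]
    by (auto simp: convex_body_def compact_imp_closed frontier_def)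
  assume wf: "weakly_fixing K n a"
  then have n: "1 \<le> n"
    using not_weakly_fixing_0[OF assms(1)] by (cases n) auto
  \<comment> \<open>Treats both senses of rotation at once: \<open>\<sigma> = 1\<close> for the left
    sectors, \<open>\<sigma> = - 1\<close> for the right ones.\<close>
  have no_center: False if \<sigma>: "\<sigma> = 1 \<or> \<sigma> = - 1"
    and p: "\<And>i. i \<in> {1..n} \<Longrightarrow> 0 < \<sigma> * (left_tangent K (a i) \<bullet> (a i - p))
      \<or> 0 < \<sigma> * (right_tangent K (a i) \<bullet> (a i - p))" for \<sigma> p
  proof -
    have "\<exists>v. (\<forall>x\<in>K. 0 \<le> rot90 v \<bullet> (x - a i)) \<and> 0 < \<sigma> * (v \<bullet> (a i - p))" if i: "i \<in> {1..n}" for i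
      using p[OF i] left_tangent_support[OF assms(1) assms(2)[OF i]]
        right_tangent_support[OF assms(1) assms(2)[OF i]] by blast
    with not_weakly_fixing_if_rotation_center[of n a K \<sigma> p, OF n aK \<sigma>] wf show False
      by blast
  qed
  show "(\<Inter>i\<in>{1..n}. L_sector K (a i)) = {}"
  proof (rule equals0I)
    fix p
    assume "p \<in> (\<Inter>i\<in>{1..n}. L_sector K (a i))"
    then show False
      using assms by (intro no_center[of 1 p]) (simp_all add: mem_L_sector)
  qed
  show "(\<Inter>i\<in>{1..n}. R_sector K (a i)) = {}"
  proof (rule equals0I)
    fix p
    assume "p \<in> (\<Inter>i\<in>{1..n}. R_sector K (a i))"
    then show False
      using assms by (intro no_center[of "-1" p]) (simp_all add: mem_R_sector)
  qed
qed (use assms in \<open>auto intro: fixing_if_closed_sectors_disjoint\<close>)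

end
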